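(* Let $\mathcal{T},\mathcal{A}\in\Pi_3$, and let $V:L_2\to\mathbb{R}^+$ (nonnegative reals) satisfy $V(0)=0$ and admit a derivative $\dot V$ along solutions of the partial integral equation (PIE) $\mathcal{T}\dot{\mathbf{x}}=\mathcal{A}\mathbf{x}$ (as defined in the context), where $\dot V$ is Lyapunov negative. Then the PIE is: (1) Exp. PIE to PDE stable if $V$ is PDE positive and PIE bounded; (2) Exp. PIE stable if $V$ is PIE positive and PIE bounded; (3) Exp. PDE stable if $V$ is PDE positive and PDE bounded; (4) Exp. PDE to PIE stable if $V$ is PIE positive and PDE bounded.
   Context: $L_2$ denotes the real Hilbert space $L_2([0,1];\mathbb{R}^m)$ with inner product $\langle\cdot,\cdot\rangle$ and norm $\|\cdot\|$. A partial integral (PI) operator is a bounded linear operator $\mathcal{P}:L_2\to L_2$ of the form $(\mathcal{P}\mathbf{x})(s)=R_0(s)\mathbf{x}(s)+\int_0^s R_1(s,\theta)\mathbf{x}(\theta)\,d\theta+\int_s^1R_2(s,\theta)\mathbf{x}(\theta)\,d\theta$ with (matrix-valued) $R_0\in L_\infty$ and $R_1,R_2\in L_2$; $\Pi_3$ is the set of all such operators. A solution of $\mathcal{T}\dot{\mathbf{x}}=\mathcal{A}\mathbf{x}$ is a differentiable function $\mathbf{x}:[0,\infty)\to L_2$ with $\mathcal{T}\dot{\mathbf{x}}(t)=\mathcal{A}\mathbf{x}(t)$ for all $t\ge 0$. (When the PIE comes from a classically well-posed PDE, $\mathcal{T}\mathbf{x}(t)$ is the PDE state; this only motivates the terminology.)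 Derivative along solutions: $V$ is assumed sufficiently regular, meaning that $t\mapsto V(\mathbf{x}(t))$ is continuous for every solution, and that there is a function $\dot V:L_2\to\mathbb{R}$ with $\dot V(\mathbf{x})=\lim_{h\to0^+}\frac{V(\hat{\mathbf{x}}(h))-V(\mathbf{x})}{h}$ for every $\mathbf{x}\in L_2$ and every solution $\hat{\mathbf{x}}$ with $\hat{\mathbf{x}}(0)=\mathbf{x}$. Properties (each inequality for all $\mathbf{x}\in L_2$): $V$ is PDE positive if $V(\mathbf{x})\ge\epsilon\|\mathcal{T}\mathbf{x}\|^2$ for some $\epsilon>0$; PIE positive if $V(\mathbf{x})\ge\epsilon\|\mathbf{x}\|^2$ for some $\epsilon>0$; PIE bounded if $V(\mathbf{x})\le C\|\mathbf{x}\|^2$ for some $C>0$; PDE bounded if $V(\mathbf{x})\le C\|\mathcal{T}\mathbf{x}\|^2$ for some $C>0$. $\dot V$ is Lyapunov negative if $\dot V(\mathbf{x})\le-\alpha V(\mathbf{x})$ for some $\alpha>0$. Stability: the PIE is called - Exp. PIE to PDE stable if there are $C,\alpha>0$ such that every solution satisfies $\|\mathcal{T}\mathbf{x}(t)\|\le Ce^{-\alpha t}\|\mathbf{x}(0)\|$ for all $t\ge0$; - Exp. PIE stable if there are $C,\alpha>0$ such that every solution satisfies $\|\mathbf{x}(t)\|\le Ce^{-\alpha t}\|\mathbf{x}(0)\|$ for all $t\ge0$; - Exp. PDE stable if there are $C,\alpha>0$ such that every solution satisfies $\|\mathcal{T}\mathbf{x}(t)\|\le Ce^{-\alpha t}\|\mathcal{T}\mathbf{x}(0)\|$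 for all $t\ge0$; - Exp. PDE to PIE stable if there are $C,\alpha>0$ such that every solution satisfies $\|\mathbf{x}(t)\|\le Ce^{-\alpha t}\|\mathcal{T}\mathbf{x}(0)\|$ for all $t\ge0$. *)

theory Defs
  imports "HOL-Analysis.Analysis"
begin

definition square_integrable :: "'a measure \<Rightarrow> ('a \<Rightarrow> 'b::real_normed_vector) \<Rightarrow> bool"
  where "square_integrable M f \<longleftrightarrow>
    f \<in> borel_measurable M \<and> integrable M (\<lambda>x. (norm (f x))\<^sup>2)"

definition essentially_bounded :: "'a measure \<Rightarrow> ('a \<Rightarrow> 'b::real_normed_vector) \<Rightarrow> bool"
  where "essentially_bounded M f \<longleftrightarrow>
    f \<in> borel_measurable M \<and> (\<exists>B. AE x in M. norm (f x) \<le> B)"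

lemma square_integrable_zero: "square_integrable M (\<lambda>x. 0)"
  by (simp add: square_integrable_def)

lemma square_integrable_scaleR:
  assumes "square_integrable M f"
  shows "square_integrable M (\<lambda>x. c *\<^sub>R f x)"
  using assms by (auto simp: square_integrable_def power_mult_distrib)

lemma square_integrable_inner:
  fixes f g :: "'a \<Rightarrow> 'b::euclidean_space"
  assumes "square_integrable M f" "square_integrable M g"
  shows "integrable M (\<lambda>x. f x \<bullet> g x)"
proof (rule Bochner_Integration.integrable_bound)
  show "integrable M (\<lambda>x. (norm (f x))\<^sup>2 + (norm (g x))\<^sup>2)"
    using assms by (auto simp: square_integrable_def)
  show "(\<lambda>x. f x \<bullet> g x) \<in> borel_measurable M"
    using assms by (auto simp: square_integrable_def)
  show "AE x in M. norm (f x \<bullet> g x) \<le> norm ((norm (f x))\<^sup>2 + (norm (g x))\<^sup>2)"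
  proof (rule AE_I2)
    fix x
    have "\<bar>f x \<bullet> g x\<bar> \<le> norm (f x) * norm (g x)"
      by (rule Cauchy_Schwarz_ineq2)
    also have "\<dots> \<le> (norm (f x))\<^sup>2 + (norm (g x))\<^sup>2"
      using sum_squares_bound[of "norm (f x)" "norm (g x)"]
        mult_nonneg_nonneg[OF norm_ge_zero[of "f x"] norm_ge_zero[of "g x"]] by linarith
    finally show "norm (f x \<bullet> g x) \<le> norm ((norm (f x))\<^sup>2 + (norm (g x))\<^sup>2)"
      by simp
  qed
qed

lemma square_integrable_add:
  fixes f g :: "'a \<Rightarrow> 'b::euclidean_space"
  assumes "square_integrable M f" "square_integrable M g"
  shows "square_integrable M (\<lambda>x. f x + g x)"
proof -
  have "(\<lambda>x. (norm (f x + g x))\<^sup>2) =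
      (\<lambda>x. (norm (f x))\<^sup>2 + (norm (g x))\<^sup>2 + 2 * (f x \<bullet> g x))"
    by (auto simp: power2_norm_eq_inner inner_add_left inner_add_right inner_commute)
  moreover have "integrable M (\<lambda>x. (norm (f x))\<^sup>2 + (norm (g x))\<^sup>2 + 2 * (f x \<bullet> g x))"
    using assms square_integrable_inner[OF assms]
    by (auto simp: square_integrable_def)
  ultimately show ?thesis
    using assms by (auto simp: square_integrable_def)
qed

text \<open>
  Elements of \<open>L\<^sub>2([0,1]; \<real>\<^sup>m)\<close> are classes of functions on the whole line that agree a.e. on
  \<open>[0,1]\<close>; the index type \<open>'m\<close> stands for \<open>m\<close>.
\<close>

definition L2_rel :: "(real \<Rightarrow> real ^ 'm) \<Rightarrow> (real \<Rightarrow> real ^ 'm) \<Rightarrow> bool"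
  where "L2_rel f g \<longleftrightarrow>
    square_integrable (lebesgue_on {0..1}) f \<and> square_integrable (lebesgue_on {0..1}) g \<and>
    (AE s in lebesgue_on {0..1}. f s = g s)"

lemma part_equivp_L2_rel: "part_equivp L2_rel"
proof (rule part_equivpI)
  show "\<exists>f::real \<Rightarrow> real ^ 'm. L2_rel f f"
    using square_integrable_zero by (auto simp: L2_rel_def)
  show "symp (L2_rel :: (real \<Rightarrow> real ^ 'm) \<Rightarrow> _)"
    by (rule sympI) (auto simp: L2_rel_def eq_commute)
  show "transp (L2_rel :: (real \<Rightarrow> real ^ 'm) \<Rightarrow> _)"
    by (rule transpI) (auto simp: L2_rel_def)
qed

quotient_type 'm L2 = "real \<Rightarrow> real ^ 'm::finite" / partial: "L2_rel"
  morphisms rep_L2 abs_L2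
  by (rule part_equivp_L2_rel)

instantiation L2 :: (finite) real_inner
begin

lift_definition zero_L2 :: "'a L2" is "\<lambda>s. 0"
  by (auto simp: L2_rel_def square_integrable_zero)

lift_definition plus_L2 :: "'a L2 \<Rightarrow> 'a L2 \<Rightarrow> 'a L2" is "\<lambda>f g s. f s + g s"
  by (auto simp: L2_rel_def square_integrable_add)

lift_definition scaleR_L2 :: "real \<Rightarrow> 'a L2 \<Rightarrow> 'a L2" is "\<lambda>c f s. c *\<^sub>R f s"
  by (auto simp: L2_rel_def square_integrable_scaleR)

definition uminus_L2 :: "'a L2 \<Rightarrow> 'a L2" where "uminus_L2 x = (-1) *\<^sub>R x"

definition minus_L2 :: "'a L2 \<Rightarrow> 'a L2 \<Rightarrow> 'a L2" where "minus_L2 x y = x + - y"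

lift_definition inner_L2 :: "'a L2 \<Rightarrow> 'a L2 \<Rightarrow> real"
  is "\<lambda>f g. LINT s|lebesgue_on {0..1}. f s \<bullet> g s"
  by (rule integral_cong_AE) (auto simp: L2_rel_def square_integrable_def)

definition norm_L2 :: "'a L2 \<Rightarrow> real" where "norm_L2 x = sqrt (inner x x)"

definition dist_L2 :: "'a L2 \<Rightarrow> 'a L2 \<Rightarrow> real" where "dist_L2 x y = norm (x - y)"

definition sgn_L2 :: "'a L2 \<Rightarrow> 'a L2" where "sgn_L2 x = inverse (norm x) *\<^sub>R x"

definition uniformity_L2 :: "('a L2 \<times> 'a L2) filter"
  where "uniformity_L2 = (INF e\<in>{0<..}. principal {(x, y). dist x y < e})"

definition open_L2 :: "'a L2 set \<Rightarrow> bool"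
  where "open_L2 U \<longleftrightarrow> (\<forall>x\<in>U. eventually (\<lambda>(x', y). x' = x \<longrightarrow> y \<in> U) uniformity)"

instance
proof
  fix x y z :: "'a L2" and c d :: real
  show "x + y + z = x + (y + z)"
    by transfer (auto simp: L2_rel_def square_integrable_add add.assoc)
  show "x + y = y + x"
    by transfer (auto simp: L2_rel_def square_integrable_add add.commute)
  show "0 + x = x"
    by transfer (auto simp: L2_rel_def)
  show "- x + x = 0"
    unfolding uminus_L2_def
    by transfer (auto simp: L2_rel_def square_integrable_add square_integrable_zero
        intro!: square_integrable_scaleR[where c = "-1", simplified])
  show "x - y = x + - y"
    by (rule minus_L2_def)
  show "c *\<^sub>R (x + y) = c *\<^sub>R x + c *\<^sub>R y"
    by transfer (auto simp: L2_rel_def square_integrable_add square_integrable_scaleR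
        scaleR_add_right)
  show "(c + d) *\<^sub>R x = c *\<^sub>R x + d *\<^sub>R x"
    by transfer (auto simp: L2_rel_def square_integrable_add square_integrable_scaleR
        scaleR_add_left)
  show "c *\<^sub>R d *\<^sub>R x = (c * d) *\<^sub>R x"
    by transfer (auto simp: L2_rel_def dest: square_integrable_scaleR)
  show "1 *\<^sub>R x = x"
    by transfer (auto simp: L2_rel_def)
  show "dist x y = norm (x - y)"
    by (rule dist_L2_def)
  show "sgn x = inverse (norm x) *\<^sub>R x"
    by (rule sgn_L2_def)
  show "uniformity = (INF e\<in>{0<..}. principal {(x, y :: 'a L2). dist x y < e})"
    by (rule uniformity_L2_def)
  show "open U \<longleftrightarrow> (\<forall>x\<in>U. eventually (\<lambda>(x', y). x' = x \<longrightarrow> y \<in> U) uniformity)"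
    for U :: "'a L2 set"
    by (rule open_L2_def)
  show "inner x y = inner y x"
    by transfer (simp add: inner_commute)
  show "inner (x + y) z = inner x z + inner y z"
    by transfer (simp add: L2_rel_def inner_add_left square_integrable_inner)
  show "inner (c *\<^sub>R x) y = c * inner x y"
    by transfer simp
  show "0 \<le> inner x x"
    by transfer (simp add: integral_nonneg_AE)
  show "inner x x = 0 \<longleftrightarrow> x = 0"
  proof transfer
    fix f :: "real \<Rightarrow> real ^ 'a"
    assume "L2_rel f f"
    then have f: "square_integrable (lebesgue_on {0..1}) f"
      by (simp add: L2_rel_def)
    have "(LINT s|lebesgue_on {0..1}. f s \<bullet> f s) = 0 \<longleftrightarrow>
        (AE s in lebesgue_on {0..1}. f s \<bullet> f s = 0)"
      by (rule integral_nonneg_eq_0_iff_AE) (auto intro: square_integrable_inner f)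
    then show "(LINT s|lebesgue_on {0..1}. f s \<bullet> f s) = 0 \<longleftrightarrow> L2_rel f (\<lambda>s. 0)"
      using f by (simp add: L2_rel_def square_integrable_zero)
  qed
  show "norm x = sqrt (inner x x)"
    by (rule norm_L2_def)
qed

end

text \<open>
  Changing a representative on a null set changes neither integral and alters the multiplier
  term only on a null set, so the choice made by \<^const>\<open>rep_L2\<close> is irrelevant.
\<close>

definition Pi3 :: "('m::finite L2 \<Rightarrow> 'm L2) set"
  where "Pi3 = {P. bounded_linear P \<and>
    (\<exists>(R0 :: real \<Rightarrow> real ^ 'm ^ 'm) (R1 :: real \<times> real \<Rightarrow> real ^ 'm ^ 'm)
        (R2 :: real \<times> real \<Rightarrow> real ^ 'm ^ 'm).
      essentially_bounded (lebesgue_on {0..1}) R0 \<and>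
      square_integrable (lebesgue_on ({0..1} \<times> {0..1})) R1 \<and>
      square_integrable (lebesgue_on ({0..1} \<times> {0..1})) R2 \<and>
      (\<forall>x. AE s in lebesgue_on {0..1}.
        rep_L2 (P x) s =
          R0 s *v rep_L2 x s
          + (LINT \<theta>:{0..s}|lebesgue. R1 (s, \<theta>) *v rep_L2 x \<theta>)
          + (LINT \<theta>:{s..1}|lebesgue. R2 (s, \<theta>) *v rep_L2 x \<theta>)))}"

text \<open>
  Time derivatives are taken in the norm of \<open>L\<^sub>2\<close>, one-sided at \<open>t = 0\<close>. Values of a solution at
  negative times are irrelevant.
\<close>

definition PIE_solution ::
    "('m::finite L2 \<Rightarrow> 'm L2) \<Rightarrow> ('m L2 \<Rightarrow> 'm L2) \<Rightarrow> (real \<Rightarrow> 'm L2) \<Rightarrow> bool"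
  where "PIE_solution T A x \<longleftrightarrow>
    (\<forall>t\<ge>0. \<exists>x'. (x has_vector_derivative x') (at t within {0..}) \<and> T x' = A (x t))"

definition derivative_along_solutions ::
    "('m::finite L2 \<Rightarrow> 'm L2) \<Rightarrow> ('m L2 \<Rightarrow> 'm L2) \<Rightarrow> ('m L2 \<Rightarrow> real) \<Rightarrow> ('m L2 \<Rightarrow> real) \<Rightarrow> bool"
  where "derivative_along_solutions T A V V' \<longleftrightarrow>
    (\<forall>x. PIE_solution T A x \<longrightarrow> continuous_on {0..} (\<lambda>t. V (x t))) \<and>
    (\<forall>x0 x. PIE_solution T A x \<and> x 0 = x0 \<longrightarrow>
      ((\<lambda>h. (V (x h) - V x0) / h) \<longlongrightarrow> V' x0) (at_right 0))"

definition PDE_positive :: "('m::finite L2 \<Rightarrow> 'm L2) \<Rightarrow> ('m L2 \<Rightarrow> real) \<Rightarrow> bool"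
  where "PDE_positive T V \<longleftrightarrow> (\<exists>\<epsilon>>0. \<forall>x. V x \<ge> \<epsilon> * (norm (T x))\<^sup>2)"

definition PIE_positive :: "('m::finite L2 \<Rightarrow> real) \<Rightarrow> bool"
  where "PIE_positive V \<longleftrightarrow> (\<exists>\<epsilon>>0. \<forall>x. V x \<ge> \<epsilon> * (norm x)\<^sup>2)"

definition PIE_bounded :: "('m::finite L2 \<Rightarrow> real) \<Rightarrow> bool"
  where "PIE_bounded V \<longleftrightarrow> (\<exists>C>0. \<forall>x. V x \<le> C * (norm x)\<^sup>2)"

definition PDE_bounded :: "('m::finite L2 \<Rightarrow> 'm L2) \<Rightarrow> ('m L2 \<Rightarrow> real) \<Rightarrow> bool"
  where "PDE_bounded T V \<longleftrightarrow> (\<exists>C>0. \<forall>x. V x \<le> C * (norm (T x))\<^sup>2)"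

definition Lyapunov_negative :: "('m::finite L2 \<Rightarrow> real) \<Rightarrow> ('m L2 \<Rightarrow> real) \<Rightarrow> bool"
  where "Lyapunov_negative V V' \<longleftrightarrow> (\<exists>\<alpha>>0. \<forall>x. V' x \<le> - \<alpha> * V x)"

definition exp_PIE_to_PDE_stable :: "('m::finite L2 \<Rightarrow> 'm L2) \<Rightarrow> ('m L2 \<Rightarrow> 'm L2) \<Rightarrow> bool"
  where "exp_PIE_to_PDE_stable T A \<longleftrightarrow> (\<exists>C>0. \<exists>\<alpha>>0. \<forall>x. PIE_solution T A x \<longrightarrow>
    (\<forall>t\<ge>0. norm (T (x t)) \<le> C * exp (- \<alpha> * t) * norm (x 0)))"

definition exp_PIE_stable :: "('m::finite L2 \<Rightarrow> 'm L2) \<Rightarrow> ('m L2 \<Rightarrow> 'm L2) \<Rightarrow> bool"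
  where "exp_PIE_stable T A \<longleftrightarrow> (\<exists>C>0. \<exists>\<alpha>>0. \<forall>x. PIE_solution T A x \<longrightarrow>
    (\<forall>t\<ge>0. norm (x t) \<le> C * exp (- \<alpha> * t) * norm (x 0)))"

definition exp_PDE_stable :: "('m::finite L2 \<Rightarrow> 'm L2) \<Rightarrow> ('m L2 \<Rightarrow> 'm L2) \<Rightarrow> bool"
  where "exp_PDE_stable T A \<longleftrightarrow> (\<exists>C>0. \<exists>\<alpha>>0. \<forall>x. PIE_solution T A x \<longrightarrow>
    (\<forall>t\<ge>0. norm (T (x t)) \<le> C * exp (- \<alpha> * t) * norm (T (x 0))))"

definition exp_PDE_to_PIE_stable :: "('m::finite L2 \<Rightarrow> 'm L2) \<Rightarrow> ('m L2 \<Rightarrow> 'm L2) \<Rightarrow> bool"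
  where "exp_PDE_to_PIE_stable T A \<longleftrightarrow> (\<exists>C>0. \<exists>\<alpha>>0. \<forall>x. PIE_solution T A x \<longrightarrow>
    (\<forall>t\<ge>0. norm (x t) \<le> C * exp (- \<alpha> * t) * norm (T (x 0))))"

end

theory Submission
  imports Defs
begin

text \<open>
  The PIE is autonomous, so a time shift of a solution is again a solution. The derivative of
  \<open>V\<close> along solutions is given at initial states only, and the shift carries it to every time:
  along a solution \<open>x\<close> the continuous function \<open>W t = V (x t)\<close> has the right derivative
  \<open>V' (x t) \<le> - \<alpha> * W t\<close>. A Gronwall argument then gives \<open>W t \<le> exp (- \<alpha> * t) * W 0\<close>.
  Since only a right derivative is available, the mean value theorem does not apply directly;
  \<open>nonincreasing_if_right_derivative_nonpos\<close> takes its place.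

  All four claims have the same shape. If \<open>V\<close> is bounded below by \<open>\<epsilon> * (p x)\<^sup>2\<close> and above by
  \<open>C * (q x)\<^sup>2\<close>, then along every solution
  \<open>\<epsilon> * (p (x t))\<^sup>2 \<le> W t \<le> exp (- \<alpha> * t) * W 0 \<le> exp (- \<alpha> * t) * C * (q (x 0))\<^sup>2\<close>,
  and taking square roots yields exponential decay of \<open>p\<close> relative to \<open>q\<close> with rate \<open>\<alpha> / 2\<close> and
  constant \<open>sqrt (C / \<epsilon>)\<close>. The four claims are the choices of \<open>p\<close> and \<open>q\<close> among \<open>norm x\<close>
  and \<open>norm (T x)\<close>.
\<close>

text \<open>
  Only a right derivative is assumed, so the argument is by a last good point: for every slope
  \<open>e > 0\<close>, the set of points where \<open>f\<close> stays below the line of slope \<open>e\<close> through \<open>(a, f a)\<close> is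
  closed, and the right derivative pushes its maximum further to the right unless that is \<open>b\<close>.
\<close>

lemma nonincreasing_if_right_derivative_nonpos:
  fixes f D :: "real \<Rightarrow> real"
  assumes "a \<le> b" and cont: "continuous_on {a..b} f"
    and deriv: "\<And>t. a \<le> t \<Longrightarrow> t < b \<Longrightarrow> (f has_real_derivative D t) (at_right t)"
    and nonpos: "\<And>t. a \<le> t \<Longrightarrow> t < b \<Longrightarrow> D t \<le> 0"
  shows "f b \<le> f a"
proof -
  have below_line: "f b - e * b \<le> f a - e * a" if "e > 0" for e
  proof -
    define S where "S = {t \<in> {a..b}. f t - e * t \<le> f a - e * a}"
    have "closed S"
      unfolding S_def
      by (intro continuous_on_closed_Collect_le continuous_intros cont)
    moreover have "bounded S"
      by (rule bounded_subset[of "{a..b}"]) (auto simp: S_def)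
    ultimately have "compact S"
      by (simp add: compact_eq_bounded_closed)
    moreover have "S \<noteq> {}"
      using \<open>a \<le> b\<close> by (auto simp: S_def)
    ultimately have "\<exists>c\<in>S. \<forall>t\<in>S. t \<le> c"
      by (rule compact_attains_sup)
    then obtain c where c: "c \<in> S" and c_max: "\<And>t. t \<in> S \<Longrightarrow> t \<le> c"
      by blast
    have "c = b"
    proof (rule ccontr)
      assume "c \<noteq> b"
      with c have "a \<le> c" "c < b" by (auto simp: S_def)
      have "((\<lambda>t. f t - e * t) has_real_derivative D c - e) (at_right c)"
        using DERIV_diff[OF deriv[OF \<open>a \<le> c\<close> \<open>c < b\<close>] DERIV_cmult[OF DERIV_ident, of e]]
        by simp
      moreover have "D c - e < 0"
        using nonpos[OF \<open>a \<le> c\<close> \<open>c < b\<close>] \<open>e > 0\<close> by simp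
      ultimately obtain d where "d > 0" and d:
        "\<And>h. 0 < h \<Longrightarrow> h < d \<Longrightarrow> f (c + h) - e * (c + h) < f c - e * c"
        using has_real_derivative_neg_dec_right[of "\<lambda>t. f t - e * t" "D c - e" c "{c<..}"]
        by auto
      define h where "h = min (d / 2) (b - c)"
      have h: "0 < h" "h < d" "c + h \<le> b"
        using \<open>d > 0\<close> \<open>c < b\<close> by (auto simp: h_def)
      then have "c + h \<in> S"
        using d[of h] c by (auto simp: S_def)
      with c_max h(1) show False by fastforce
    qed
    with c show ?thesis by (simp add: S_def)
  qed
  have lim: "((\<lambda>e. f t - e * t) \<longlongrightarrow> f t - 0 * t) (at_right 0)" for t
    by (intro tendsto_intros)
  have "\<forall>\<^sub>F e in at_right 0. f b - e * b \<le> f a - e * a"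
    using eventually_at_right_less[of 0] by (rule eventually_mono) (rule below_line)
  from tendsto_le[OF trivial_limit_at_right_real lim lim this] show ?thesis
    by simp
qed

text \<open>
  Multiplying by the integrating factor \<open>exp (\<alpha> * t)\<close> turns the differential inequality into a
  nonpositive right derivative.
\<close>

lemma gronwall_right_derivative:
  fixes W D :: "real \<Rightarrow> real"
  assumes cont: "continuous_on {0..} W"
    and deriv: "\<And>t. t \<ge> 0 \<Longrightarrow> (W has_real_derivative D t) (at_right t)"
    and bound: "\<And>t. t \<ge> 0 \<Longrightarrow> D t \<le> - \<alpha> * W t"
    and "t \<ge> 0"
  shows "W t \<le> exp (- \<alpha> * t) * W 0"
proof -
  have "exp (\<alpha> * t) * W t \<le> exp (\<alpha> * 0) * W 0"
  proof (rule nonincreasing_if_right_derivative_nonpos[OF \<open>t \<ge> 0\<close>])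
    show "continuous_on {0..t} (\<lambda>s. exp (\<alpha> * s) * W s)"
      by (intro continuous_intros continuous_on_subset[OF cont]) auto
    show "((\<lambda>s. exp (\<alpha> * s) * W s) has_real_derivative
        exp (\<alpha> * s) * (\<alpha> * W s + D s)) (at_right s)" if "0 \<le> s" for s
    proof -
      have "((\<lambda>s. exp (\<alpha> * s)) has_real_derivative exp (\<alpha> * s) * \<alpha>) (at_right s)"
        by (auto intro!: derivative_eq_intros)
      from DERIV_mult[OF this deriv[OF that]] show ?thesis
        by (simp add: algebra_simps)
    qed
    show "exp (\<alpha> * s) * (\<alpha> * W s + D s) \<le> 0" if "0 \<le> s" for s
      using bound[OF that] by (intro mult_nonneg_nonpos) auto
  qed
  then have "exp (- \<alpha> * t) * (exp (\<alpha> * t) * W t) \<le> exp (- \<alpha> * t) * W 0"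
    by (intro mult_left_mono) auto
  then show ?thesis
    by (simp add: mult.assoc[symmetric] exp_add[symmetric])
qed

lemma PIE_solution_shift:
  assumes "PIE_solution T A x" and "t \<ge> 0"
  shows "PIE_solution T A (\<lambda>s. x (t + s))"
  unfolding PIE_solution_def
proof (intro allI impI)
  fix s :: real assume "s \<ge> 0"
  then obtain x' where x': "(x has_vector_derivative x') (at (t + s) within {0..})"
    and "T x' = A (x (t + s))"
    using assms unfolding PIE_solution_def by (meson add_nonneg_nonneg)
  have "(x has_vector_derivative x') (at (t + s) within (\<lambda>s. t + s) ` {0..})"
    by (rule has_vector_derivative_within_subset[OF x']) (use \<open>t \<ge> 0\<close> in auto)
  moreover have "((\<lambda>s. t + s) has_vector_derivative 1) (at s within {0..})"
    by (auto intro!: derivative_eq_intros)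
  ultimately have "((\<lambda>s. x (t + s)) has_vector_derivative x') (at s within {0..})"
    using vector_diff_chain_within[of "\<lambda>s. t + s" 1 s "{0..}" x x'] by (simp add: o_def)
  with \<open>T x' = A (x (t + s))\<close>
  show "\<exists>x'. ((\<lambda>s. x (t + s)) has_vector_derivative x') (at s within {0..}) \<and>
      T x' = A (x (t + s))"
    by blast
qed

lemma right_derivative_along_solution:
  assumes "derivative_along_solutions T A V V'" and "PIE_solution T A x" and "t \<ge> 0"
  shows "((\<lambda>s. V (x s)) has_real_derivative V' (x t)) (at_right t)"
proof -
  have "((\<lambda>h. (V (y h) - V (y 0)) / h) \<longlongrightarrow> V' (y 0)) (at_right 0)"
    if "PIE_solution T A y" for y
    using assms(1) that unfolding derivative_along_solutions_def by blast
  from this[OF PIE_solution_shift[OF assms(2,3)]]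
  have "((\<lambda>h. (V (x (t + h)) - V (x t)) / h) \<longlongrightarrow> V' (x t)) (at_right 0)"
    by simp
  then show ?thesis
    by (simp add: has_field_derivative_iff filterlim_at_right_to_0[of _ _ t] add.commute)
qed

lemma Lyapunov_function_decay:
  assumes deriv: "derivative_along_solutions T A V V'" and "PIE_solution T A x"
    and "\<And>x. V' x \<le> - \<alpha> * V x" and "t \<ge> 0"
  shows "V (x t) \<le> exp (- \<alpha> * t) * V (x 0)"
proof (rule gronwall_right_derivative)
  show "continuous_on {0..} (\<lambda>t. V (x t))"
    using assms(1,2) by (simp add: derivative_along_solutions_def)
  show "((\<lambda>t. V (x t)) has_real_derivative V' (x s)) (at_right s)" if "s \<ge> 0" for s
    by (rule right_derivative_along_solution[OF assms(1,2) that])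
qed (rule assms(3) assms(4))+

text \<open>
  The common form of all stability claims: \<open>p\<close> is the size that \<open>V\<close> controls from below, \<open>q\<close> the
  size that controls \<open>V\<close> from above. Both are squared in the hypotheses, so the square root halves
  the rate.
\<close>

lemma exponential_decay_between_sizes:
  fixes p q :: "'m::finite L2 \<Rightarrow> real"
  assumes deriv: "derivative_along_solutions T A V V'" and "Lyapunov_negative V V'"
    and q: "\<And>x. q x \<ge> 0"
    and "\<exists>\<epsilon>>0. \<forall>x. V x \<ge> \<epsilon> * (p x)\<^sup>2"
    and "\<exists>C>0. \<forall>x. V x \<le> C * (q x)\<^sup>2"
  shows "\<exists>C>0. \<exists>\<alpha>>0. \<forall>x. PIE_solution T A x \<longrightarrow>
    (\<forall>t\<ge>0. p (x t) \<le> C * exp (- \<alpha> * t) * q (x 0))"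
proof -
  obtain \<alpha> where "\<alpha> > 0" and \<alpha>: "\<And>x. V' x \<le> - \<alpha> * V x"
    using \<open>Lyapunov_negative V V'\<close> by (auto simp: Lyapunov_negative_def)
  obtain \<epsilon> where "\<epsilon> > 0" and \<epsilon>: "\<And>x. \<epsilon> * (p x)\<^sup>2 \<le> V x"
    using assms(4) by auto
  obtain C where "C > 0" and C: "\<And>x. V x \<le> C * (q x)\<^sup>2"
    using assms(5) by auto
  have "p (x t) \<le> sqrt (C / \<epsilon>) * exp (- (\<alpha> / 2) * t) * q (x 0)"
    if "PIE_solution T A x" and "t \<ge> 0" for x t
  proof (rule power2_le_imp_le)
    have "\<epsilon> * (p (x t))\<^sup>2 \<le> V (x t)" by (rule \<epsilon>)
    also have "\<dots> \<le> exp (- \<alpha> * t) * V (x 0)"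
      by (rule Lyapunov_function_decay[OF deriv that(1) \<alpha> that(2)])
    also have "\<dots> \<le> exp (- \<alpha> * t) * (C * (q (x 0))\<^sup>2)"
      by (intro mult_left_mono C) simp
    finally have "(p (x t))\<^sup>2 \<le> C / \<epsilon> * exp (- \<alpha> * t) * (q (x 0))\<^sup>2"
      using \<open>\<epsilon> > 0\<close> by (simp add: field_simps)
    also have "exp (- \<alpha> * t) = (exp (- (\<alpha> / 2) * t))\<^sup>2"
      by (simp add: exp_double[symmetric])
    also have "C / \<epsilon> = (sqrt (C / \<epsilon>))\<^sup>2"
      using \<open>C > 0\<close> \<open>\<epsilon> > 0\<close> by simp
    finally show "(p (x t))\<^sup>2 \<le> (sqrt (C / \<epsilon>) * exp (- (\<alpha> / 2) * t) * q (x 0))\<^sup>2"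
      by (simp only: power_mult_distrib)
    show "0 \<le> sqrt (C / \<epsilon>) * exp (- (\<alpha> / 2) * t) * q (x 0)"
      using \<open>C > 0\<close> \<open>\<epsilon> > 0\<close> q by simp
  qed
  moreover have "sqrt (C / \<epsilon>) > 0" "\<alpha> / 2 > 0"
    using \<open>C > 0\<close> \<open>\<epsilon> > 0\<close> \<open>\<alpha> > 0\<close> by simp_all
  ultimately show ?thesis by blast
qed

theorem lemma4:
  fixes T A :: "'m::finite L2 \<Rightarrow> 'm L2"
    and V V' :: "'m L2 \<Rightarrow> real"
  assumes "T \<in> Pi3" and "A \<in> Pi3"
    and "\<And>x. V x \<ge> 0" and "V 0 = 0"
    and "derivative_along_solutions T A V V'"
    and "Lyapunov_negative V V'"
  shows "(PDE_positive T V \<and> PIE_bounded V \<longrightarrow> exp_PIE_to_PDE_stable T A) \<and>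
    (PIE_positive V \<and> PIE_bounded V \<longrightarrow> exp_PIE_stable T A) \<and>
    (PDE_positive T V \<and> PDE_bounded T V \<longrightarrow> exp_PDE_stable T A) \<and>
    (PIE_positive V \<and> PDE_bounded T V \<longrightarrow> exp_PDE_to_PIE_stable T A)"
proof -
  note decay = exponential_decay_between_sizes[OF assms(5,6)]
  note props = PDE_positive_def PIE_positive_def PIE_bounded_def PDE_bounded_def
  show ?thesis
    unfolding exp_PIE_to_PDE_stable_def exp_PIE_stable_def exp_PDE_stable_def
      exp_PDE_to_PIE_stable_def props
    by (intro conjI impI; (elim conjE)?; rule decay; (assumption | simp))
qed

end
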